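(* There are absolute constants $c,C>0$ with the following property. Let $N\ge2$ be an integer and suppose $r\geq\sqrt2$ is real with $$r(\log N)^{3/2}\leq cN.$$ Then, uniformly in $q$ (that is, for every integer $1\le q\le\binom N2$), $$|\mathcal A_{N,q}(r)|\leq2^{C rN(\log N)^{3/2}\left(1+\log\frac{N}{r(\log N)^{3/2}}\right)}.$$
   Context: All logarithms are natural. For integers $N\geq2$, $1\leq q\leq\binom N2$ and real $r>0$, $\mathcal A_{N,q}(r)$ denotes the set of adjacency matrices ($N\times N$ matrices with entries in $\{0,1\}$, symmetric, zero diagonal, indexed by $\mathbb Z_N=\mathbb Z/N\mathbb Z$) of labeled simple graphs on the vertex set $\mathbb Z_N$ with exactly $q$ edges and Fourier ratio at most $r$. The Fourier ratio of a nonzero $N\times N$ matrix $A$ is $\operatorname{FR}(A)=\|FAF\|_1/\|FAF\|_2$, where $F$ is the unitary Fourier matrix $F_{mx}=\frac1{\sqrt N}e^{-2\pi i mx/N}$, $\|\cdot\|_1$ is the entrywise $\ell^1$-norm and $\|\cdot\|_2$ is the Frobenius norm. *)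

theory Defs
  imports Complex_Main "Jordan_Normal_Form.Matrix"
begin

text \<open>
  The dimension \<open>N\<close> varies inside the statement, so matrices are \<open>complex mat\<close> with explicit
  dimensions. The index set of residues modulo \<open>N\<close> is represented by the residues
  \<open>0, \<dots>, N - 1\<close>, that is, by the natural numbers below \<open>N\<close>.
\<close>

definition fourier_mat :: "nat \<Rightarrow> complex mat" where
  "fourier_mat N = mat N N (\<lambda>(m, x).
     exp (- (2 * of_real pi * \<i> * of_nat m * of_nat x / of_nat N)) / of_real (sqrt (real N)))"

definition entrywise_l1 :: "complex mat \<Rightarrow> real" where
  "entrywise_l1 A = (\<Sum>i<dim_row A. \<Sum>j<dim_col A. cmod (A $$ (i, j)))"

definition frobenius_norm :: "complex mat \<Rightarrow> real" where
  "frobenius_norm A = sqrt (\<Sum>i<dim_row A. \<Sum>j<dim_col A. (cmod (A $$ (i, j)))\<^sup>2)"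

text \<open>
  Meant for nonzero square matrices; at the zero matrix the value is \<open>0 / 0 = 0\<close>.
\<close>

definition fourier_ratio :: "complex mat \<Rightarrow> real" where
  "fourier_ratio A =
     (let F = fourier_mat (dim_row A); B = F * A * F in entrywise_l1 B / frobenius_norm B)"

text \<open>
  A labeled simple graph on \<open>{..<N}\<close> is identified with its set of edges, the edges being
  two-element subsets of the vertex set. Loops are excluded by \<open>card e = 2\<close>, so adjacency
  matrices have zero diagonal (\<open>{i, i}\<close> is a singleton), and they are symmetric since
  \<open>{i, j} = {j, i}\<close>.
\<close>

definition simple_graphs :: "nat \<Rightarrow> nat set set set" where
  "simple_graphs N = {E. \<forall>e\<in>E. e \<subseteq> {..<N} \<and> card e = 2}"

definition adjacency_mat :: "nat \<Rightarrow> nat set set \<Rightarrow> complex mat" where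
  "adjacency_mat N E = mat N N (\<lambda>(i, j). if {i, j} \<in> E then 1 else 0)"

definition adjacency_mats_FR :: "nat \<Rightarrow> nat \<Rightarrow> real \<Rightarrow> complex mat set" where
  "adjacency_mats_FR N q r =
     {adjacency_mat N E | E.
        E \<in> simple_graphs N \<and> card E = q \<and> fourier_ratio (adjacency_mat N E) \<le> r}"

end

theory Submission
  imports Defs
begin

text \<open>
  By Parseval, \<open>\<parallel>FAF\<parallel>\<^sub>2 = \<parallel>A\<parallel>\<^sub>2 \<le> N\<close>, so Fourier ratio at most \<open>r\<close> gives \<open>\<parallel>FAF\<parallel>\<^sub>1 \<le> r N\<close>.
  Fourier inversion then places the entry function of \<open>A\<close> in the convex hull of at most \<open>4 N\<^sup>2\<close>
  real atoms bounded by \<open>2 r\<close>. A Maurey-type greedy choice finds \<open>k = \<lceil>r N\<rceil>\<close> atoms whose average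
  is within \<open>16 r\<^sup>2 N\<^sup>2 / k\<close> of \<open>A\<close> in squared \<open>\<ell>\<^sup>2\<close> distance, and rounding this average at \<open>1/2\<close>
  recovers \<open>A\<close> up to at most \<open>64 r N\<close> wrong entries. Counting the tuples of atoms and the error sets
  gives \<open>exp (O (r N log N))\<close>, which is stronger than the stated bound.
\<close>

section \<open>Sparse approximation and counting of approximable sets\<close>

text \<open>A derandomized Maurey argument: \<open>support\<close> is the dual form of
  \<open>f\<close> lying in the convex hull of \<open>D\<close>. Each new atom is chosen against the
  accumulated error, so the squared error grows only linearly in \<open>k\<close>, and that of the
  average decays like \<open>1/k\<close>.\<close>

lemma greedy_approximation:
  fixes f :: "'a \<Rightarrow> real" and D :: "('a \<Rightarrow> real) set"
  assumes support: "\<And>g. \<exists>d\<in>D. (\<Sum>x\<in>X. g x * f x) \<le> (\<Sum>x\<in>X. g x * d x)"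
    and bound: "\<And>d x. d \<in> D \<Longrightarrow> x \<in> X \<Longrightarrow> \<bar>f x - d x\<bar> \<le> R"
  shows "\<exists>ds. set ds \<subseteq> D \<and> length ds = k \<and>
    (\<Sum>x\<in>X. (real k * f x - (\<Sum>d\<leftarrow>ds. d x))\<^sup>2) \<le> real k * (real (card X) * R\<^sup>2)"
proof (induction k)
  case 0
  show ?case by simp
next
  case (Suc k)
  then obtain ds where ds: "set ds \<subseteq> D" "length ds = k"
    and IH: "(\<Sum>x\<in>X. (real k * f x - (\<Sum>d\<leftarrow>ds. d x))\<^sup>2) \<le> real k * (real (card X) * R\<^sup>2)"
    by blast
  define e where "e = (\<lambda>x. real k * f x - (\<Sum>d\<leftarrow>ds. d x))"
  \<comment> \<open>Testing \<open>support\<close> with the current error \<open>e\<close> yields an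
    atom for which the cross term \<open>2 * e * (f - d)\<close> sums to at most 0.\<close>
  obtain d where d: "d \<in> D" "(\<Sum>x\<in>X. e x * f x) \<le> (\<Sum>x\<in>X. e x * d x)"
    using support by blast
  have sq: "(f x - d x)\<^sup>2 \<le> R\<^sup>2" if "x \<in> X" for x
    using bound[OF d(1) that] by (metis abs_ge_zero power2_abs power_mono)
  have "(\<Sum>x\<in>X. (real (Suc k) * f x - (\<Sum>d\<leftarrow>d # ds. d x))\<^sup>2)
      = (\<Sum>x\<in>X. (e x)\<^sup>2 + 2 * (e x * f x - e x * d x) + (f x - d x)\<^sup>2)"
    by (intro sum.cong) (auto simp: e_def power2_eq_square algebra_simps)
  also have "\<dots> = (\<Sum>x\<in>X. (e x)\<^sup>2) + 2 * ((\<Sum>x\<in>X. e x * f x) - (\<Sum>x\<in>X. e x * d x))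
      + (\<Sum>x\<in>X. (f x - d x)\<^sup>2)"
    by (simp add: sum.distrib sum_subtractf flip: sum_distrib_left)
  also have "\<dots> \<le> real k * (real (card X) * R\<^sup>2) + 0 + real (card X) * R\<^sup>2"
  proof (intro add_mono)
    show "(\<Sum>x\<in>X. (f x - d x)\<^sup>2) \<le> real (card X) * R\<^sup>2"
      using sq by (rule sum_bounded_above)
  qed (use IH d in \<open>auto simp: e_def\<close>)
  also have "\<dots> = real (Suc k) * (real (card X) * R\<^sup>2)"
    by (simp add: algebra_simps)
  finally show ?case
    using ds d(1) by (intro exI[of _ "d # ds"]) auto
qed

text \<open>An enumeration of a small set, padded with \<open>None\<close> to length exactly
  \<open>M\<close>, is a word over an alphabet of \<open>card X + 1\<close> letters from which the
  set can be read off.\<close>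

lemma card_small_subsets_le:
  assumes "finite X"
  shows "card {S. S \<subseteq> X \<and> card S \<le> M} \<le> (card X + 1) ^ M"
proof -
  let ?L = "{xs. set xs \<subseteq> insert None (Some ` X) \<and> length xs = M}"
  have "{S. S \<subseteq> X \<and> card S \<le> M} \<subseteq> (\<lambda>xs. {x. Some x \<in> set xs}) ` ?L"
  proof
    fix S assume "S \<in> {S. S \<subseteq> X \<and> card S \<le> M}"
    then have S: "S \<subseteq> X" "card S \<le> M" by auto
    then obtain ys where ys: "set ys = S" "length ys = card S"
      using assms finite_distinct_list distinct_card finite_subset by metis
    show "S \<in> (\<lambda>xs. {x. Some x \<in> set xs}) ` ?L"
    proof (rule image_eqI)
      show "S = {x. Some x \<in> set (map Some ys @ replicate (M - card S) None)}"
        using ys by auto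
    qed (use S ys in auto)
  qed
  moreover have "finite ?L"
    using assms by (intro finite_lists_length_eq) auto
  ultimately have "card {S. S \<subseteq> X \<and> card S \<le> M} \<le> card ?L"
    by (rule surj_card_le[rotated])
  also have "\<dots> = (card X + 1) ^ M"
    using assms by (subst card_lists_length_eq) (auto simp: card_insert_if card_image)
  finally show ?thesis .
qed

text \<open>A set \<open>T\<close> is encoded by \<open>k\<close> atoms whose average approximates
  its indicator, together with the set of points where rounding that average gives the wrong answer.
  Hypothesis \<open>M\<close> makes the latter set have at most \<open>M\<close> elements.\<close>

lemma card_approximable_sets_le:
  fixes X :: "'a set" and D :: "('a \<Rightarrow> real) set"
  assumes "finite X" "finite D" "k > 0"
    and sub: "\<And>T. T \<in> \<F> \<Longrightarrow> T \<subseteq> X"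
    and support: "\<And>T g. T \<in> \<F> \<Longrightarrow>
      \<exists>d\<in>D. (\<Sum>x\<in>X. g x * of_bool (x \<in> T)) \<le> (\<Sum>x\<in>X. g x * d x)"
    and bound: "\<And>T d x. T \<in> \<F> \<Longrightarrow> d \<in> D \<Longrightarrow> x \<in> X \<Longrightarrow> \<bar>of_bool (x \<in> T) - d x\<bar> \<le> R"
    and M: "4 * real (card X) * R\<^sup>2 < real k * real (M + 1)"
  shows "card \<F> \<le> card D ^ k * (card X + 1) ^ M"
proof -
  let ?L = "{ds. set ds \<subseteq> D \<and> length ds = k}"
  let ?S = "{S. S \<subseteq> X \<and> card S \<le> M}"
  define dec where "dec ds = {x\<in>X. (\<Sum>d\<leftarrow>ds. d x) > real k / 2}" for ds :: "('a \<Rightarrow> real) list"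
  have "\<exists>ds\<in>?L. card (sym_diff T (dec ds)) \<le> M" if T: "T \<in> \<F>" for T
  proof -
    let ?f = "\<lambda>x. of_bool (x \<in> T) :: real"
    have "\<exists>ds. set ds \<subseteq> D \<and> length ds = k \<and>
        (\<Sum>x\<in>X. (real k * ?f x - (\<Sum>d\<leftarrow>ds. d x))\<^sup>2) \<le> real k * (real (card X) * R\<^sup>2)"
      by (intro greedy_approximation support[OF T] bound[OF T])
    then obtain ds where ds: "ds \<in> ?L"
      and err: "(\<Sum>x\<in>X. (real k * ?f x - (\<Sum>d\<leftarrow>ds. d x))\<^sup>2) \<le> real k * (real (card X) * R\<^sup>2)"
      by blast
    define S where "S = sym_diff T (dec ds)"
    have SX: "S \<subseteq> X" using sub[OF T] by (auto simp: S_def dec_def)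
    \<comment> \<open>At a wrongly decoded point the average lies on the wrong side of 1/2 (or at
      1/2), so the sum of the atoms misses \<open>k * ?f x\<close> by at least
      \<open>k / 2\<close>.\<close>
    have "real (card S) * (real k / 2)\<^sup>2 \<le> (\<Sum>x\<in>S. (real k * ?f x - (\<Sum>d\<leftarrow>ds. d x))\<^sup>2)"
    proof (rule sum_bounded_below)
      fix x assume "x \<in> S"
      then have "real k / 2 \<le> \<bar>real k * ?f x - (\<Sum>d\<leftarrow>ds. d x)\<bar>"
        using sub[OF T] by (auto simp: S_def dec_def)
      then show "(real k / 2)\<^sup>2 \<le> (real k * ?f x - (\<Sum>d\<leftarrow>ds. d x))\<^sup>2"
        by (metis abs_le_square_iff abs_of_nonneg divide_nonneg_nonneg of_nat_0_le_iff zero_le_numeral)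
    qed
    also have "\<dots> \<le> (\<Sum>x\<in>X. (real k * ?f x - (\<Sum>d\<leftarrow>ds. d x))\<^sup>2)"
      using SX \<open>finite X\<close> by (intro sum_mono2) auto
    also note err
    finally have "real k * (real k * real (card S)) \<le> real k * (4 * real (card X) * R\<^sup>2)"
      by (simp add: power2_eq_square field_simps)
    then have "real k * real (card S) \<le> 4 * real (card X) * R\<^sup>2"
      using \<open>k > 0\<close> by simp
    \<comment> \<open>The strict bound by \<open>M + 1\<close> becomes \<open>card S \<le> M\<close>
      because cardinalities are integers.\<close>
    with M have "real k * real (card S) < real k * real (M + 1)" by linarith
    then have "card S \<le> M" using \<open>k > 0\<close> by simp
    with ds show ?thesis unfolding S_def by blast
  qed
  then have "\<forall>T\<in>\<F>. \<exists>ds. ds \<in> ?L \<and> card (sym_diff T (dec ds)) \<le> M" by blast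
  from bchoice[OF this] obtain enc
    where enc: "\<And>T. T \<in> \<F> \<Longrightarrow> enc T \<in> ?L \<and> card (sym_diff T (dec (enc T))) \<le> M"
    by blast
  have fin: "finite ?L" "finite ?S"
    using assms(1,2) by (auto intro: finite_lists_length_eq)
  have "card \<F> \<le> card (?L \<times> ?S)"
  proof (rule card_inj_on_le)
    show "inj_on (\<lambda>T. (enc T, sym_diff T (dec (enc T)))) \<F>"
    proof (rule inj_onI)
      fix T T' assume "(enc T, sym_diff T (dec (enc T))) = (enc T', sym_diff T' (dec (enc T')))"
      then have e: "enc T = enc T'"
        and "sym_diff T (dec (enc T)) = sym_diff T' (dec (enc T'))" by blast+
      then have "sym_diff T (dec (enc T')) = sym_diff T' (dec (enc T'))" by (simp only: e)
      \<comment> \<open>Symmetric difference with one fixed set can be cancelled.\<close>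
      then show "T = T'" by blast
    qed
    show "(\<lambda>T. (enc T, sym_diff T (dec (enc T)))) ` \<F> \<subseteq> ?L \<times> ?S"
    proof (rule image_subsetI)
      fix T assume T: "T \<in> \<F>"
      then have "sym_diff T (dec (enc T)) \<subseteq> X" using sub by (auto simp: dec_def)
      with enc[OF T] show "(enc T, sym_diff T (dec (enc T))) \<in> ?L \<times> ?S" by blast
    qed
  qed (use fin in blast)
  also have "\<dots> \<le> card D ^ k * (card X + 1) ^ M"
    unfolding card_cartesian_product card_lists_length_eq[OF \<open>finite D\<close>]
    by (intro mult_left_mono card_small_subsets_le \<open>finite X\<close>) auto
  finally show ?thesis .
qed

section \<open>Orthogonality, inversion and Parseval for the Fourier matrix\<close>

text \<open>Writing an entry as an \<open>m\<close>-th power turns sums over \<open>m\<close> into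
  geometric series.\<close>

lemma fourier_mat_index:
  assumes "m < N" "x < N"
  shows "fourier_mat N $$ (m, x) = cnj (cis (2 * pi * real x / real N)) ^ m / of_real (sqrt (real N))"
proof -
  have "cnj (cis (2 * pi * real x / real N)) ^ m = cis (- (2 * pi * real m * real x / real N))"
    by (simp add: cis_cnj DeMoivre algebra_simps)
  then show ?thesis
    using assms by (simp add: fourier_mat_def cis_conv_exp mult_ac)
qed

lemma fourier_mat_sym:
  assumes "m < N" "x < N"
  shows "fourier_mat N $$ (m, x) = fourier_mat N $$ (x, m)"
  using assms by (simp add: fourier_mat_def mult_ac)

lemma cmod_fourier_mat:
  assumes "m < N" "x < N"
  shows "cmod (fourier_mat N $$ (m, x)) = 1 / sqrt (real N)"
  using assms by (simp add: fourier_mat_index norm_divide norm_power)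

text \<open>The summands form a geometric progression whose ratio \<open>w a / w x\<close> is an
  \<open>N\<close>-th root of unity, equal to 1 only for \<open>a = x\<close>.\<close>

lemma fourier_mat_orthogonal:
  assumes "a < N" "x < N"
  shows "(\<Sum>m<N. cnj (fourier_mat N $$ (m, a)) * fourier_mat N $$ (m, x)) = of_bool (a = x)"
proof -
  define w where "w = (\<lambda>x. cis (2 * pi * real x / real N))"
  have N: "N > 0" using assms by auto
  have w_ne [simp]: "w y \<noteq> 0" for y by (simp add: w_def)
  have cw: "cnj (w y) = inverse (w y)" for y by (simp add: w_def cis_cnj)
  have wN: "w y ^ N = 1" for y
    using N by (simp add: w_def DeMoivre cis_multiple_2pi)
  have summand: "cnj (fourier_mat N $$ (m, a)) * fourier_mat N $$ (m, x) = (w a / w x) ^ m / of_nat N"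
    if "m < N" for m
  proof -
    have "complex_of_real (sqrt (real N)) * of_real (sqrt (real N)) = of_nat N"
      by (metis of_nat_0_le_iff of_real_mult of_real_of_nat_eq real_sqrt_mult_self abs_of_nonneg)
    then show ?thesis
      using that assms cw
      by (simp add: fourier_mat_index flip: w_def fun_cong[OF w_def])
         (simp add: power_divide power_inverse divide_simps)
  qed
  show ?thesis
  proof (cases "a = x")
    case True
    then show ?thesis using summand N by simp
  next
    case False
    have "inj_on (\<lambda>k. cis (2 * pi * real k / real N)) {..<N}"
      using bij_betw_roots_unity[OF N] by (auto simp: bij_betw_def)
    with False assms have "w a \<noteq> w x"
      by (auto simp: w_def dest: inj_onD)
    then have "(\<Sum>m<N. (w a / w x) ^ m) = 0"
      using wN by (subst geometric_sum) (simp_all add: power_divide)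
    then show ?thesis using summand False by (simp flip: sum_divide_distrib)
  qed
qed

text \<open>Symmetry of \<open>F\<close> lets the right factor be indexed by frequency first, which
  exhibits \<open>FAF\<close> as a two-dimensional Fourier transform.\<close>

lemma fourier_transform_index:
  assumes "A \<in> carrier_mat N N" "m < N" "n < N"
  shows "(fourier_mat N * A * fourier_mat N) $$ (m, n)
    = (\<Sum>x<N. \<Sum>y<N. fourier_mat N $$ (m, x) * A $$ (x, y) * fourier_mat N $$ (n, y))"
proof -
  have F: "fourier_mat N \<in> carrier_mat N N" by (simp add: fourier_mat_def)
  have "(fourier_mat N * A * fourier_mat N) $$ (m, n)
    = (\<Sum>x<N. \<Sum>y<N. fourier_mat N $$ (m, x) * A $$ (x, y) * fourier_mat N $$ (y, n))"
    using assms F by (simp add: scalar_prod_def atLeast0LessThan sum_distrib_left mult.assoc)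
  also have "\<dots> = (\<Sum>x<N. \<Sum>y<N. fourier_mat N $$ (m, x) * A $$ (x, y) * fourier_mat N $$ (n, y))"
    using fourier_mat_sym[OF _ \<open>n < N\<close>] by simp
  finally show ?thesis .
qed

lemma sum_swap_pairs:
  "(\<Sum>a\<in>A. \<Sum>b\<in>B. \<Sum>c\<in>C. \<Sum>d\<in>D. f a b c d) = (\<Sum>c\<in>C. \<Sum>d\<in>D. \<Sum>a\<in>A. \<Sum>b\<in>B. f a b c d)"
proof -
  have "(\<Sum>a\<in>A. \<Sum>b\<in>B. \<Sum>c\<in>C. \<Sum>d\<in>D. f a b c d) = (\<Sum>a\<in>A. \<Sum>c\<in>C. \<Sum>b\<in>B. \<Sum>d\<in>D. f a b c d)"
    by (rule sum.cong[OF refl], rule sum.swap)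
  also have "\<dots> = (\<Sum>c\<in>C. \<Sum>a\<in>A. \<Sum>d\<in>D. \<Sum>b\<in>B. f a b c d)"
    by (subst sum.swap) (rule sum.cong[OF refl], rule sum.cong[OF refl], rule sum.swap)
  also have "\<dots> = (\<Sum>c\<in>C. \<Sum>d\<in>D. \<Sum>a\<in>A. \<Sum>b\<in>B. f a b c d)"
    by (rule sum.cong[OF refl], rule sum.swap)
  finally show ?thesis .
qed

text \<open>After expanding \<open>FAF\<close> and exchanging the sums, the sums over
  \<open>m\<close> and \<open>n\<close> factor, and orthogonality in each leaves only the term at
  \<open>(x, y)\<close>.\<close>

lemma fourier_inversion:
  assumes A: "A \<in> carrier_mat N N" and xy: "x < N" "y < N"
  defines "F \<equiv> fourier_mat N"
  shows "A $$ (x, y) = (\<Sum>m<N. \<Sum>n<N. (F * A * F) $$ (m, n) * cnj (F $$ (m, x) * F $$ (n, y)))"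
proof -
  have "(\<Sum>m<N. \<Sum>n<N. (F * A * F) $$ (m, n) * cnj (F $$ (m, x) * F $$ (n, y)))
    = (\<Sum>m<N. \<Sum>n<N. \<Sum>a<N. \<Sum>b<N.
        A $$ (a, b) * (cnj (F $$ (m, x)) * F $$ (m, a)) * (cnj (F $$ (n, y)) * F $$ (n, b)))"
    unfolding F_def
    by (intro sum.cong refl)
       (simp add: fourier_transform_index[OF A] sum_distrib_left mult_ac)
  also have "\<dots> = (\<Sum>a<N. \<Sum>b<N. \<Sum>m<N. \<Sum>n<N.
        A $$ (a, b) * (cnj (F $$ (m, x)) * F $$ (m, a)) * (cnj (F $$ (n, y)) * F $$ (n, b)))"
    by (rule sum_swap_pairs)
  also have "\<dots> = (\<Sum>a<N. \<Sum>b<N. A $$ (a, b) * ((\<Sum>m<N. cnj (F $$ (m, x)) * F $$ (m, a))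
        * (\<Sum>n<N. cnj (F $$ (n, y)) * F $$ (n, b))))"
    by (simp only: sum_product) (simp add: sum_distrib_left mult.assoc)
  also have "\<dots> = (\<Sum>a<N. \<Sum>b<N. if y = b then if x = a then A $$ (a, b) else 0 else 0)"
    using xy unfolding F_def by (intro sum.cong refl) (simp add: fourier_mat_orthogonal)
  also have "\<dots> = A $$ (x, y)"
    using xy by simp
  finally show ?thesis ..
qed

text \<open>Parseval: in \<open>A * cnj A\<close> only the conjugated factor is expanded by
  inversion; after exchanging the sums, the rest reassembles into an entry of
  \<open>B\<close>.\<close>

lemma frobenius_norm_fourier:
  assumes A: "A \<in> carrier_mat N N"
  shows "frobenius_norm (fourier_mat N * A * fourier_mat N) = frobenius_norm A"
proof -
  define F B where "F = fourier_mat N" and "B = F * A * F"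
  have dim: "dim_row B = N" "dim_col B = N"
    using A by (auto simp: B_def F_def fourier_mat_def)
  have "complex_of_real (\<Sum>x<N. \<Sum>y<N. (cmod (A $$ (x, y)))\<^sup>2)
      = (\<Sum>x<N. \<Sum>y<N. A $$ (x, y) * cnj (A $$ (x, y)))"
    by (simp add: complex_norm_square del: of_real_power)
  also have "\<dots> = (\<Sum>x<N. \<Sum>y<N. \<Sum>m<N. \<Sum>n<N.
      cnj (B $$ (m, n)) * (F $$ (m, x) * A $$ (x, y) * F $$ (n, y)))"
  proof (intro sum.cong refl)
    fix x y assume "x \<in> {..<N}" "y \<in> {..<N}"
    then have "cnj (A $$ (x, y)) = (\<Sum>m<N. \<Sum>n<N. cnj (B $$ (m, n)) * (F $$ (m, x) * F $$ (n, y)))"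
      by (subst fourier_inversion[OF A]) (simp_all add: B_def F_def)
    then show "A $$ (x, y) * cnj (A $$ (x, y)) = (\<Sum>m<N. \<Sum>n<N.
        cnj (B $$ (m, n)) * (F $$ (m, x) * A $$ (x, y) * F $$ (n, y)))"
      by (simp add: sum_distrib_left mult_ac)
  qed
  also have "\<dots> = (\<Sum>m<N. \<Sum>n<N. \<Sum>x<N. \<Sum>y<N.
      cnj (B $$ (m, n)) * (F $$ (m, x) * A $$ (x, y) * F $$ (n, y)))"
    by (rule sum_swap_pairs)
  also have "\<dots> = (\<Sum>m<N. \<Sum>n<N. B $$ (m, n) * cnj (B $$ (m, n)))"
  proof (intro sum.cong refl)
    fix m n assume "m \<in> {..<N}" "n \<in> {..<N}"
    then have B: "B $$ (m, n) = (\<Sum>x<N. \<Sum>y<N. F $$ (m, x) * A $$ (x, y) * F $$ (n, y))"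
      using fourier_transform_index[OF A] by (simp add: B_def F_def)
    show "(\<Sum>x<N. \<Sum>y<N. cnj (B $$ (m, n)) * (F $$ (m, x) * A $$ (x, y) * F $$ (n, y)))
        = B $$ (m, n) * cnj (B $$ (m, n))"
      unfolding sum_distrib_left[symmetric] B[symmetric] by (rule mult.commute)
  qed
  also have "\<dots> = complex_of_real (\<Sum>m<N. \<Sum>n<N. (cmod (B $$ (m, n)))\<^sup>2)"
    by (simp add: complex_norm_square del: of_real_power)
  finally have "(\<Sum>x<N. \<Sum>y<N. (cmod (A $$ (x, y)))\<^sup>2) = (\<Sum>m<N. \<Sum>n<N. (cmod (B $$ (m, n)))\<^sup>2)"
    by (simp only: of_real_eq_iff)
  then show ?thesis
    using A dim by (simp add: frobenius_norm_def flip: B_def F_def)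
qed


section \<open>Real Fourier atoms and their convex hull\<close>

text \<open>One of the real and imaginary parts has at least half the modulus. Allowing only four
  rotations keeps the family of atoms finite, at the price of a factor 2.\<close>

lemma exists_unit_rotation:
  fixes z :: complex
  shows "\<exists>u\<in>{1, -1, \<i>, -\<i>}. cmod z \<le> 2 * Re (u * z)"
proof -
  have "cmod z \<le> \<bar>Re z\<bar> + \<bar>Im z\<bar>" by (rule cmod_le)
  then consider "cmod z \<le> 2 * Re z" | "cmod z \<le> - 2 * Re z" | "cmod z \<le> 2 * Im z" | "cmod z \<le> - 2 * Im z"
    by linarith
  then show ?thesis by cases auto
qed

text \<open>Real parts of rotated two-dimensional characters. The scale \<open>r * N\<close> is the
  bound on the \<open>l1\<close> norm of \<open>FAF\<close>, and the 2 pays for the restriction to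
  four rotations.\<close>

definition fourier_atoms :: "nat \<Rightarrow> real \<Rightarrow> (nat \<times> nat \<Rightarrow> real) set" where
  "fourier_atoms N r = (\<lambda>(u, m, n) (x, y).
      2 * (r * real N * Re (u * cnj (fourier_mat N $$ (m, x) * fourier_mat N $$ (n, y)))))
    ` ({1, -1, \<i>, -\<i>} \<times> {..<N} \<times> {..<N})"

lemma finite_fourier_atoms: "finite (fourier_atoms N r)"
  by (simp add: fourier_atoms_def)

lemma card_fourier_atoms_le: "card (fourier_atoms N r) \<le> 4 * N\<^sup>2"
proof -
  have "card (fourier_atoms N r) \<le> card ({1, -1, \<i>, -\<i>} \<times> {..<N} \<times> {..<N})"
    unfolding fourier_atoms_def by (rule card_image_le) simp
  also have "\<dots> \<le> 4 * N\<^sup>2"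
    unfolding card_cartesian_product
    by (auto simp: power2_eq_square card_insert_if)
  finally show ?thesis .
qed

lemma abs_fourier_atom_le:
  assumes "d \<in> fourier_atoms N r" "x < N" "y < N" "r \<ge> 0"
  shows "\<bar>d (x, y)\<bar> \<le> 2 * r"
proof -
  obtain u m n where u: "u \<in> {1, -1, \<i>, -\<i>}" and mn: "m < N" "n < N"
    and d: "d (x, y) = 2 * (r * real N * Re (u * cnj (fourier_mat N $$ (m, x) * fourier_mat N $$ (n, y))))"
    using assms(1) unfolding fourier_atoms_def by (auto simp del: insert_iff)
  have "\<bar>Re (u * cnj (fourier_mat N $$ (m, x) * fourier_mat N $$ (n, y)))\<bar>
      \<le> cmod (u * cnj (fourier_mat N $$ (m, x) * fourier_mat N $$ (n, y)))"
    by (rule abs_Re_le_cmod)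
  also have "\<dots> = 1 / real N"
    using assms u mn by (auto simp: norm_mult cmod_fourier_mat)
  finally have "r * real N * \<bar>Re (u * cnj (fourier_mat N $$ (m, x) * fourier_mat N $$ (n, y)))\<bar>
      \<le> r * real N * (1 / real N)"
    using assms by (intro mult_left_mono) auto
  also have "\<dots> = r" using assms by simp
  finally show ?thesis using assms by (simp add: d abs_mult)
qed

text \<open>Duality of \<open>l1\<close> and the maximum norm: by inversion, pairing
  \<open>g\<close> with \<open>a\<close> equals pairing \<open>B\<close> with the transform
  \<open>h\<close> of \<open>g\<close>, which is at most \<open>r * N * max |h|\<close>. A suitably
  rotated atom at the frequency maximizing \<open>|h|\<close> reaches this value.\<close>

lemma fourier_atoms_support:
  fixes a g :: "nat \<times> nat \<Rightarrow> real"
  assumes A: "A \<in> carrier_mat N N" and "N > 0"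
    and a: "\<And>x y. x < N \<Longrightarrow> y < N \<Longrightarrow> A $$ (x, y) = of_real (a (x, y))"
    and l1: "entrywise_l1 (fourier_mat N * A * fourier_mat N) \<le> r * real N"
  shows "\<exists>d\<in>fourier_atoms N r.
    (\<Sum>p\<in>{..<N} \<times> {..<N}. g p * a p) \<le> (\<Sum>p\<in>{..<N} \<times> {..<N}. g p * d p)"
proof -
  define F B where "F = fourier_mat N" and "B = F * A * F"
  let ?X = "{..<N} \<times> {..<N}"
  define h where "h = (\<lambda>(m, n). \<Sum>(x, y)\<in>?X. of_real (g (x, y)) * cnj (F $$ (m, x) * F $$ (n, y)))"
  have dim: "dim_row B = N" "dim_col B = N"
    using A by (auto simp: B_def F_def fourier_mat_def)
  have fin: "finite ((\<lambda>p. cmod (h p)) ` ?X)" and "(\<lambda>p. cmod (h p)) ` ?X \<noteq> {}"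
    using \<open>N > 0\<close> by auto
  \<comment> \<open>A frequency \<open>(m0, n0)\<close> at which the modulus of \<open>h\<close> is
    largest.\<close>
  then have "Max ((\<lambda>p. cmod (h p)) ` ?X) \<in> (\<lambda>p. cmod (h p)) ` ?X" by (rule Max_in)
  then obtain m0 n0 where mn0: "m0 < N" "n0 < N"
    and Max: "Max ((\<lambda>p. cmod (h p)) ` ?X) = cmod (h (m0, n0))"
    by (elim imageE) (erule SigmaE, simp)
  have max: "cmod (h p) \<le> cmod (h (m0, n0))" if "p \<in> ?X" for p
    unfolding Max[symmetric] by (rule Max_ge[OF fin imageI[OF that]])
  obtain u where u: "u \<in> {1, -1, \<i>, -\<i>}" "cmod (h (m0, n0)) \<le> 2 * Re (u * h (m0, n0))"
    using exists_unit_rotation by blast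
  define d where "d = (\<lambda>(x, y). 2 * (r * real N * Re (u * cnj (F $$ (m0, x) * F $$ (n0, y)))))"
  have "d \<in> fourier_atoms N r"
    unfolding fourier_atoms_def
    by (rule image_eqI[where x = "(u, m0, n0)"]) (use u mn0 in \<open>auto simp: d_def F_def\<close>)
  have "complex_of_real (\<Sum>p\<in>?X. g p * a p) = (\<Sum>(x, y)\<in>?X. of_real (g (x, y)) * A $$ (x, y))"
    by (auto simp: a intro!: sum.cong)
  also have "\<dots> = (\<Sum>(x, y)\<in>?X. \<Sum>(m, n)\<in>?X.
      B $$ (m, n) * (of_real (g (x, y)) * cnj (F $$ (m, x) * F $$ (n, y))))"
    by (auto simp: fourier_inversion[OF A] B_def F_def sum.cartesian_product sum_distrib_left
        mult_ac intro!: sum.cong)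
  also have "\<dots> = (\<Sum>(m, n)\<in>?X. B $$ (m, n) * h (m, n))"
    unfolding case_prod_unfold h_def by (subst sum.swap) (simp add: sum_distrib_left)
  finally have "\<bar>\<Sum>p\<in>?X. g p * a p\<bar> = cmod (\<Sum>(m, n)\<in>?X. B $$ (m, n) * h (m, n))"
    by (metis norm_of_real)
  also have "\<dots> \<le> (\<Sum>(m, n)\<in>?X. cmod (B $$ (m, n)) * cmod (h (m0, n0)))"
    unfolding case_prod_unfold
    by (rule order.trans[OF norm_sum], rule sum_mono)
       (use max in \<open>auto simp: norm_mult intro!: mult_left_mono\<close>)
  also have "\<dots> = entrywise_l1 B * cmod (h (m0, n0))"
    by (simp add: entrywise_l1_def dim sum.cartesian_product sum_distrib_right case_prod_unfold)
  also have "\<dots> \<le> r * real N * cmod (h (m0, n0))"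
    using l1 by (intro mult_right_mono) (simp_all add: B_def F_def)
  also have "\<dots> \<le> r * real N * (2 * Re (u * h (m0, n0)))"
  proof (rule mult_left_mono[OF u(2)])
    \<comment> \<open>The sign of \<open>r * N\<close> comes from \<open>l1\<close>, an upper bound
      on a nonnegative norm.\<close>
    have "entrywise_l1 B \<ge> 0" by (simp add: entrywise_l1_def sum_nonneg)
    then show "r * real N \<ge> 0" using l1 by (simp add: B_def F_def)
  qed
  also have "\<dots> = (\<Sum>p\<in>?X. g p * d p)"
  proof -
    have "u * h (m0, n0) = (\<Sum>p\<in>?X. of_real (g p) * (u * cnj (F $$ (m0, fst p) * F $$ (n0, snd p))))"
      by (simp add: h_def case_prod_unfold sum_distrib_left mult_ac)
    then have "Re (u * h (m0, n0)) = (\<Sum>p\<in>?X. g p * Re (u * cnj (F $$ (m0, fst p) * F $$ (n0, snd p))))"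
      by (simp only: Re_sum times_complex.sel Re_complex_of_real Im_complex_of_real
          mult_zero_left diff_zero)
    then show ?thesis
      by (simp add: d_def case_prod_unfold sum_distrib_left mult_ac)
  qed
  finally show ?thesis using \<open>d \<in> _\<close> by (intro bexI[of _ d]) auto
qed

section \<open>Counting adjacency matrices of small Fourier ratio\<close>

lemma fourier_ratio_leD:
  assumes A: "A \<in> carrier_mat N N" and "\<And>x y. x < N \<Longrightarrow> y < N \<Longrightarrow> cmod (A $$ (x, y)) \<le> 1"
    and FR: "fourier_ratio A \<le> r" and "r \<ge> 0"
  shows "entrywise_l1 (fourier_mat N * A * fourier_mat N) \<le> r * real N"
proof -
  define B where "B = fourier_mat N * A * fourier_mat N"
  have "(\<Sum>x<N. \<Sum>y<N. (cmod (A $$ (x, y)))\<^sup>2) \<le> (\<Sum>x<N. \<Sum>y<N. 1)"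
    using assms(2) by (intro sum_mono) (auto simp: power_le_one)
  then have "frobenius_norm A \<le> sqrt ((real N)\<^sup>2)"
    unfolding frobenius_norm_def using A by (intro real_sqrt_le_mono) (simp add: power2_eq_square)
  then have norm_le: "frobenius_norm B \<le> real N"
    using frobenius_norm_fourier[OF A] by (simp add: B_def)
  have "entrywise_l1 B \<le> r * frobenius_norm B"
  proof (cases "frobenius_norm B = 0")
    \<comment> \<open>Here the ratio is \<open>0 / 0 = 0\<close> and says nothing about the
      \<open>l1\<close> norm, but all entries of \<open>B\<close> vanish.\<close>
    case True
    have "(\<Sum>i<dim_row B. \<Sum>j<dim_col B. (cmod (B $$ (i, j)))\<^sup>2) = 0"
      using True by (simp add: frobenius_norm_def)
    then have "entrywise_l1 B = 0"
      by (simp add: entrywise_l1_def sum_nonneg_eq_0_iff sum_nonneg)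
    then show ?thesis using True by simp
  next
    case False
    moreover have "frobenius_norm B \<ge> 0" by (simp add: frobenius_norm_def sum_nonneg)
    ultimately show ?thesis
      using FR A by (simp add: fourier_ratio_def Let_def field_simps flip: B_def)
  qed
  also have "\<dots> \<le> r * real N" using norm_le \<open>r \<ge> 0\<close> by (rule mult_left_mono)
  finally show ?thesis by (simp add: B_def)
qed

lemma card_adjacency_mats_FR_le:
  assumes "N > 0" "r \<ge> 1"
  shows "card (adjacency_mats_FR N q r)
    \<le> (4 * N\<^sup>2) ^ nat \<lceil>r * real N\<rceil> * (N\<^sup>2 + 1) ^ nat \<lfloor>64 * (r * real N)\<rfloor>"
proof -
  define X where "X = {..<N} \<times> {..<N}"
  define supp where "supp A = {p\<in>X. A $$ p = 1}" for A :: "complex mat"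
  \<comment> \<open>Both parameters have order \<open>r * N\<close>, which balances the cost of the
    list of atoms against that of the error set.\<close>
  define k M where "k = nat \<lceil>r * real N\<rceil>" and "M = nat \<lfloor>64 * (r * real N)\<rfloor>"
  let ?AA = "adjacency_mats_FR N q r"
  have AA: "A \<in> carrier_mat N N" "\<And>p. p \<in> X \<Longrightarrow> A $$ p = of_real (of_bool (p \<in> supp A))"
    "fourier_ratio A \<le> r" if "A \<in> ?AA" for A
    using that by (auto simp: adjacency_mats_FR_def adjacency_mat_def supp_def X_def)
  \<comment> \<open>A 0/1 matrix of known size is determined by its support, so supports can be
    counted instead.\<close>
  have "inj_on supp ?AA"
  proof (rule inj_onI)
    fix A B assume AB: "A \<in> ?AA" "B \<in> ?AA" "supp A = supp B"
    show "A = B"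
    proof (rule eq_matI)
      fix i j assume "i < dim_row B" "j < dim_col B"
      then have "(i, j) \<in> X" using AA(1)[OF AB(2)] by (auto simp: X_def)
      then show "A $$ (i, j) = B $$ (i, j)"
        using AA(2)[OF AB(1)] AA(2)[OF AB(2)] AB(3) by metis
    qed (use AA(1)[OF AB(1)] AA(1)[OF AB(2)] in auto)
  qed
  then have "card ?AA = card (supp ` ?AA)" by (simp add: card_image)
  \<comment> \<open>Atoms are bounded by \<open>2 * r\<close> and indicators by
    \<open>1 \<le> r\<close>, so \<open>R = 4 * r\<close> is safe. Then
    \<open>4 * N^2 * R^2 = 64 * (r * N)^2\<close>, whence the 64 in \<open>M\<close>.\<close>
  also have "\<dots> \<le> card (fourier_atoms N r) ^ k * (card X + 1) ^ M"
  proof (rule card_approximable_sets_le[where R = "4 * r"])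
    show "k > 0" using assms by (simp add: k_def)
    show "T \<subseteq> X" if "T \<in> supp ` ?AA" for T using that by (auto simp: supp_def)
    show "\<exists>d\<in>fourier_atoms N r. (\<Sum>x\<in>X. g x * of_bool (x \<in> T)) \<le> (\<Sum>x\<in>X. g x * d x)"
      if T: "T \<in> supp ` ?AA" for T g
    proof -
      obtain A where A: "A \<in> ?AA" "T = supp A" using T by blast
      have entry: "A $$ (x, y) = of_real (of_bool ((x, y) \<in> T))" if "x < N" "y < N" for x y
        using AA(2)[OF A(1)] that by (simp add: X_def A(2))
      have "entrywise_l1 (fourier_mat N * A * fourier_mat N) \<le> r * real N"
        using AA[OF A(1)] entry assms by (intro fourier_ratio_leD) auto
      then show ?thesis
        unfolding X_def using AA(1)[OF A(1)] entry assms by (intro fourier_atoms_support) auto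
    qed
    show "\<bar>of_bool (x \<in> T) - d x\<bar> \<le> 4 * r" if "d \<in> fourier_atoms N r" "x \<in> X" for T d x
    proof -
      have "\<bar>d x\<bar> \<le> 2 * r"
        using that assms abs_fourier_atom_le[of d N r "fst x" "snd x"] by (auto simp: X_def)
      then show ?thesis using assms by (auto simp: of_bool_def)
    qed
    have "r * real N \<le> real k" unfolding k_def by (rule real_nat_ceiling_ge)
    moreover have "64 * (r * real N) < real (M + 1)" unfolding M_def using assms by linarith
    moreover have "r * real N > 0" using assms by simp
    ultimately have "(r * real N) * (64 * (r * real N)) < real k * real (M + 1)"
      by (intro mult_le_less_imp_less) auto
    then show "4 * real (card X) * (4 * r)\<^sup>2 < real k * real (M + 1)"
      by (simp add: X_def card_cartesian_product power2_eq_square mult_ac)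
  qed (use finite_fourier_atoms in \<open>auto simp: X_def\<close>)
  also have "\<dots> \<le> (4 * N\<^sup>2) ^ k * (N\<^sup>2 + 1) ^ M"
    using card_fourier_atoms_le
    by (intro mult_mono power_mono) (auto simp: X_def card_cartesian_product power2_eq_square)
  finally show ?thesis by (simp add: k_def M_def)
qed

text \<open>Both bases are at most \<open>N^4\<close> because \<open>N \<ge> 2\<close>. Since
  \<open>r * N \<ge> 1\<close> absorbs the rounding in \<open>k\<close>, the exponents add up to at
  most \<open>66 * r * N\<close>; hence \<open>264 = 4 * 66\<close>.\<close>

lemma card_adjacency_mats_FR_le_exp:
  assumes "N \<ge> 2" "r \<ge> 1"
  shows "real (card (adjacency_mats_FR N q r)) \<le> exp (264 * (r * real N) * ln (real N))"
proof -
  define k M where "k = nat \<lceil>r * real N\<rceil>" and "M = nat \<lfloor>64 * (r * real N)\<rfloor>"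
  have "1 * 1 \<le> r * real N" using assms by (intro mult_mono) auto
  then have kM: "real (k + M) \<le> 66 * (r * real N)"
    unfolding k_def M_def by linarith
  have "2 * 2 \<le> N * N" using assms by (intro mult_mono) auto
  then have N4: "4 * N\<^sup>2 \<le> N ^ 4" "N\<^sup>2 + 1 \<le> N ^ 4"
  proof -
    assume *: "2 * 2 \<le> N * N"
    then have "4 * N\<^sup>2 \<le> N\<^sup>2 * N\<^sup>2" by (intro mult_right_mono) (auto simp: power2_eq_square)
    then show "4 * N\<^sup>2 \<le> N ^ 4" by (simp flip: power_add)
    then show "N\<^sup>2 + 1 \<le> N ^ 4" using * by (simp add: power2_eq_square)
  qed
  have "card (adjacency_mats_FR N q r) \<le> (4 * N\<^sup>2) ^ k * (N\<^sup>2 + 1) ^ M"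
    using card_adjacency_mats_FR_le[of N r q] assms by (simp add: k_def M_def)
  also have "\<dots> \<le> (N ^ 4) ^ k * (N ^ 4) ^ M"
    using N4 by (intro mult_mono power_mono) auto
  also have "\<dots> = N ^ (4 * (k + M))" by (simp add: power_add power_mult distrib_left)
  finally have "real (card (adjacency_mats_FR N q r)) \<le> real N ^ (4 * (k + M))"
    by (metis of_nat_le_iff of_nat_power)
  also have "\<dots> = exp (real (4 * (k + M)) * ln (real N))"
    unfolding exp_of_nat_mult using assms by simp
  also have "\<dots> \<le> exp (264 * (r * real N) * ln (real N))"
    using kM assms by (intro iffD2[OF exp_le_cancel_iff] mult_right_mono) auto
  finally show ?thesis .
qed

section \<open>Comparison with the stated exponent\<close>

theorem theorem4p4:
  shows "\<exists>c C :: real. c > 0 \<and> C > 0 \<and>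
    (\<forall>(N::nat) (r::real). N \<ge> 2 \<longrightarrow> r \<ge> sqrt 2 \<longrightarrow>
       r * ln (real N) powr (3/2) \<le> c * real N \<longrightarrow>
       (\<forall>q::nat. 1 \<le> q \<and> q \<le> N choose 2 \<longrightarrow>
          real (card (adjacency_mats_FR N q r))
            \<le> 2 powr (C * r * real N * ln (real N) powr (3/2)
                  * (1 + ln (real N / (r * ln (real N) powr (3/2)))))))"
\<comment> \<open>One factor \<open>1 / ln 2\<close> in \<open>C\<close> changes base
  \<open>e\<close> to base 2; the other comes from
  \<open>L * ln 2 \<le> L powr (3/2)\<close>.\<close>
proof (rule exI[of _ 1], rule exI[of _ "264 / (ln 2)\<^sup>2"], intro conjI allI impI)
  fix N q :: nat and r :: real
  assume N: "N \<ge> 2" and r: "r \<ge> sqrt 2" and le: "r * ln (real N) powr (3/2) \<le> 1 * real N"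
  have r1: "r \<ge> 1" using r real_sqrt_ge_one[of 2] by linarith
  define L where "L = ln (real N)"
  define t where "t = ln (real N / (r * L powr (3/2)))"
  have "L \<ge> ln 2" unfolding L_def using N by simp
  then have L: "L > 0" by (rule less_le_trans[rotated]) simp
  \<comment> \<open>With \<open>c = 1\<close> the smallness hypothesis says that the quotient inside
    the logarithm is at least 1, so the factor \<open>1 + t\<close> can only enlarge the
    bound.\<close>
  have t: "t \<ge> 0"
    unfolding t_def using le L r1 N by (intro ln_ge_zero) (simp add: L_def)
  \<comment> \<open>For \<open>N = 2\<close> the value of \<open>L\<close> is below 1, so
    \<open>L \<le> L powr (3/2)\<close> fails; \<open>ln 2\<close> is a lower bound for
    \<open>sqrt L\<close> valid for all \<open>N \<ge> 2\<close>.\<close>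
  have "ln 2 \<le> sqrt L"
  proof (rule real_le_rsqrt)
    have "ln (2::real) \<le> 1" using ln_le_minus_one[of "2::real"] by simp
    then have "(ln 2)\<^sup>2 \<le> ln (2::real)"
      by (simp add: power2_eq_square mult_left_le)
    then show "(ln 2)\<^sup>2 \<le> L" using \<open>L \<ge> ln 2\<close> by linarith
  qed
  then have "L * ln 2 \<le> L * sqrt L" using L by simp
  also have "\<dots> = L powr (3/2)"
  proof -
    have "L powr (1 + 1/2) = L powr 1 * L powr (1/2)" by (rule powr_add)
    then show ?thesis using L by (simp add: powr_half_sqrt)
  qed
  also have "\<dots> \<le> L powr (3/2) * (1 + t)" using t by (simp add: mult_le_cancel_left1)
  finally have "264 * (r * real N) * (L * ln 2) \<le> 264 * (r * real N) * (L powr (3/2) * (1 + t))"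
    using r1 by (intro mult_left_mono) auto
  then have "264 * (r * real N) * L \<le> 264 * (r * real N) * (L powr (3/2) * (1 + t)) / ln 2"
    by (simp add: pos_le_divide_eq mult_ac)
  also have "\<dots> = 264 / (ln 2)\<^sup>2 * r * real N * L powr (3/2) * (1 + t) * ln 2"
    by (simp add: power2_eq_square)
  finally have "264 * (r * real N) * L
      \<le> 264 / (ln 2)\<^sup>2 * r * real N * L powr (3/2) * (1 + t) * ln 2" .
  then have "exp (264 * (r * real N) * L)
      \<le> 2 powr (264 / (ln 2)\<^sup>2 * r * real N * L powr (3/2) * (1 + t))"
    by (simp add: powr_def)
  with card_adjacency_mats_FR_le_exp[OF N r1, of q]
  show "real (card (adjacency_mats_FR N q r))
      \<le> 2 powr (264 / (ln 2)\<^sup>2 * r * real N * ln (real N) powr (3/2)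
        * (1 + ln (real N / (r * ln (real N) powr (3/2)))))"
    unfolding L_def t_def by linarith
qed simp_all

end
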